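(* Let $a,b$ be positive integers, let $g$ be a Riemannian (or semi-Riemannian) metric on a smooth manifold $M_n$, and let $F$ be an almost product structure and $J$ a metallic structure on $M_n$ related by $J=\frac{a}{2}I+\frac{2\rho_{a,b}-a}{2}F$, equivalently $F=\frac{2}{2\rho_{a,b}-a}J-\frac{a}{2\rho_{a,b}-a}I$. Then $F$ is a $g$-symmetric endomorphism if and only if $J$ is a $g$-symmetric endomorphism.
   Context: All manifolds and tensor fields are $C^\infty$; $\chi(M_n)$ is the set of vector fields on $M_n$ and $I$ is the identity. A metallic structure is a $(1,1)$-tensor field $J$ with $J^2=aJ+bI$, an almost product structure is a $(1,1)$-tensor field $F$ with $F^2=I$, and $\rho_{a,b}=\frac{a+\sqrt{a^2+4b}}{2}$. A $(1,1)$-tensor field $A$ is a $g$-symmetric endomorphism if $g(AX,Y)=g(X,AY)$ for all $X,Y\in\chi(M_n)$. *)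

theory Defs
  imports "HOL-Analysis.Analysis"
begin

section \<open>Smooth manifolds\<close>

fun Ck_on :: "nat \<Rightarrow> 'e::euclidean_space set \<Rightarrow> ('e \<Rightarrow> 'f::real_normed_vector) \<Rightarrow> bool"
  where
    "Ck_on 0 S f \<longleftrightarrow> continuous_on S f"
  | "Ck_on (Suc k) S f \<longleftrightarrow>
       (\<forall>x\<in>S. f differentiable (at x)) \<and>
       (\<forall>v. Ck_on k S (\<lambda>x. frechet_derivative f (at x) v))"

text \<open>Only meant for open \<open>S\<close>, because the derivatives are taken at \<open>at x\<close>.\<close>
definition smooth_on :: "'e::euclidean_space set \<Rightarrow> ('e \<Rightarrow> 'f::real_normed_vector) \<Rightarrow> bool"
  where "smooth_on S f \<longleftrightarrow> (\<forall>k. Ck_on k S f)"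

type_synonym ('a, 'n) chart = "'a set \<times> ('a \<Rightarrow> real ^ 'n)"

record ('a, 'n) manifold =
  space_of :: "'a topology"
  atlas_of :: "('a, 'n) chart set"

abbreviation points :: "('a, 'n, 'z) manifold_scheme \<Rightarrow> 'a set"
  where "points M \<equiv> topspace (space_of M)"

definition is_chart :: "'a topology \<Rightarrow> ('a, 'n::finite) chart \<Rightarrow> bool"
  where "is_chart T c \<longleftrightarrow>
    (case c of (U, \<phi>) \<Rightarrow>
       openin T U \<and> open (\<phi> ` U) \<and>
       homeomorphic_map (subtopology T U) (top_of_set (\<phi> ` U)) \<phi>)"

definition smoothly_compatible :: "('a, 'n::finite) chart \<Rightarrow> ('a, 'n) chart \<Rightarrow> bool"
  where "smoothly_compatible c d \<longleftrightarrow>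
    (case (c, d) of ((U, \<phi>), (V, \<psi>)) \<Rightarrow>
       smooth_on (\<phi> ` (U \<inter> V)) (\<psi> \<circ> inv_into U \<phi>) \<and>
       smooth_on (\<psi> ` (U \<inter> V)) (\<phi> \<circ> inv_into V \<psi>))"

text \<open>
  The atlas is not required to be maximal. It has the same smooth functions as the
  unique maximal atlas containing it, and all later notions only depend on these.
\<close>
definition smooth_manifold :: "('a, 'n::finite) manifold \<Rightarrow> bool"
  where "smooth_manifold M \<longleftrightarrow>
    Hausdorff_space (space_of M) \<and>
    second_countable (space_of M) \<and>
    (\<forall>c\<in>atlas_of M. is_chart (space_of M) c) \<and>
    (\<Union>(U, \<phi>)\<in>atlas_of M. U) = points M \<and>
    (\<forall>c\<in>atlas_of M. \<forall>d\<in>atlas_of M. smoothly_compatible c d)"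

text \<open>Values outside \<open>points M\<close> are unconstrained.\<close>
definition smooth_functions :: "('a, 'n::finite) manifold \<Rightarrow> ('a \<Rightarrow> real) set"
  where "smooth_functions M =
    {f. \<forall>(U, \<phi>)\<in>atlas_of M. smooth_on (\<phi> ` U) (f \<circ> inv_into U \<phi>)}"


section \<open>Tangent vectors and vector fields\<close>

text \<open>
  Tangent vectors at \<open>p\<close> are the derivations at \<open>p\<close> of the algebra of smooth functions.
  Fixing the value \<open>0\<close> off the smooth functions makes HOL equality of tangent vectors the
  intended one. A derivation ignores the values of \<open>f\<close> outside \<open>points M\<close>: if \<open>h\<close> vanishes
  on \<open>points M\<close> then \<open>h = h * k\<close> for some smooth \<open>k\<close> vanishing there too, so \<open>v h = 0\<close>
  by the Leibniz rule.
\<close>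
type_synonym 'a tangent = "('a \<Rightarrow> real) \<Rightarrow> real"

definition tangent_space :: "('a, 'n::finite) manifold \<Rightarrow> 'a \<Rightarrow> 'a tangent set"
  where "tangent_space M p =
    {v. (\<forall>f\<in>smooth_functions M. \<forall>h\<in>smooth_functions M.
           v (\<lambda>x. f x + h x) = v f + v h \<and>
           v (\<lambda>x. f x * h x) = f p * v h + h p * v f) \<and>
        (\<forall>f\<in>smooth_functions M. \<forall>c. v (\<lambda>x. c * f x) = c * v f) \<and>
        (\<forall>f. f \<notin> smooth_functions M \<longrightarrow> v f = 0)}"

definition tcomb :: "real \<Rightarrow> 'a tangent \<Rightarrow> real \<Rightarrow> 'a tangent \<Rightarrow> 'a tangent"
  where "tcomb c v d w = (\<lambda>f. c * v f + d * w f)"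

definition vector_fields :: "('a, 'n::finite) manifold \<Rightarrow> ('a \<Rightarrow> 'a tangent) set"
  where "vector_fields M =
    {X. (\<forall>p\<in>points M. X p \<in> tangent_space M p) \<and>
        (\<forall>f\<in>smooth_functions M. (\<lambda>p. X p f) \<in> smooth_functions M)}"


section \<open>Endomorphism fields and metrics\<close>

type_synonym 'a endo_field = "'a \<Rightarrow> 'a tangent \<Rightarrow> 'a tangent"
type_synonym 'a form_field = "'a \<Rightarrow> 'a tangent \<Rightarrow> 'a tangent \<Rightarrow> real"

text \<open>A \<open>(1,1)\<close>-tensor field, seen as a smooth field of endomorphisms of the tangent spaces.\<close>
definition tensor_field_11 :: "('a, 'n::finite) manifold \<Rightarrow> 'a endo_field \<Rightarrow> bool"
  where "tensor_field_11 M A \<longleftrightarrow>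
    (\<forall>p\<in>points M. \<forall>v\<in>tangent_space M p. A p v \<in> tangent_space M p) \<and>
    (\<forall>p\<in>points M. \<forall>v\<in>tangent_space M p. \<forall>w\<in>tangent_space M p. \<forall>c d.
       A p (tcomb c v d w) = tcomb c (A p v) d (A p w)) \<and>
    (\<forall>X\<in>vector_fields M. (\<lambda>p. A p (X p)) \<in> vector_fields M)"

definition tensor_eq :: "('a, 'n::finite) manifold \<Rightarrow> 'a endo_field \<Rightarrow> 'a endo_field \<Rightarrow> bool"
  where "tensor_eq M A B \<longleftrightarrow> (\<forall>p\<in>points M. \<forall>v\<in>tangent_space M p. A p v = B p v)"

definition id_field :: "'a endo_field"
  where "id_field = (\<lambda>p v. v)"

definition comp_field :: "'a endo_field \<Rightarrow> 'a endo_field \<Rightarrow> 'a endo_field"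
  where "comp_field A B = (\<lambda>p v. A p (B p v))"

definition comb_field :: "real \<Rightarrow> 'a endo_field \<Rightarrow> real \<Rightarrow> 'a endo_field \<Rightarrow> 'a endo_field"
  where "comb_field c A d B = (\<lambda>p v. tcomb c (A p v) d (B p v))"

definition symmetric_tensor_field_02 ::
    "('a, 'n::finite) manifold \<Rightarrow> 'a form_field \<Rightarrow> bool"
  where "symmetric_tensor_field_02 M g \<longleftrightarrow>
    (\<forall>p\<in>points M. \<forall>u\<in>tangent_space M p. \<forall>v\<in>tangent_space M p. g p u v = g p v u) \<and>
    (\<forall>p\<in>points M. \<forall>u\<in>tangent_space M p. \<forall>v\<in>tangent_space M p. \<forall>w\<in>tangent_space M p.
       \<forall>c d. g p (tcomb c u d v) w = c * g p u w + d * g p v w) \<and>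
    (\<forall>X\<in>vector_fields M. \<forall>Y\<in>vector_fields M.
       (\<lambda>p. g p (X p) (Y p)) \<in> smooth_functions M)"

definition riemannian_metric :: "('a, 'n::finite) manifold \<Rightarrow> 'a form_field \<Rightarrow> bool"
  where "riemannian_metric M g \<longleftrightarrow>
    symmetric_tensor_field_02 M g \<and>
    (\<forall>p\<in>points M. \<forall>v\<in>tangent_space M p. v \<noteq> (\<lambda>f. 0) \<longrightarrow> g p v v > 0)"

text \<open>
  Constancy of the index is not demanded; by continuity it is automatic on each
  connected component.
\<close>
definition semi_riemannian_metric :: "('a, 'n::finite) manifold \<Rightarrow> 'a form_field \<Rightarrow> bool"
  where "semi_riemannian_metric M g \<longleftrightarrow>
    symmetric_tensor_field_02 M g \<and>
    (\<forall>p\<in>points M. \<forall>v\<in>tangent_space M p.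
       (\<forall>w\<in>tangent_space M p. g p v w = 0) \<longrightarrow> v = (\<lambda>f. 0))"

definition g_symmetric ::
    "('a, 'n::finite) manifold \<Rightarrow> 'a form_field \<Rightarrow> 'a endo_field \<Rightarrow> bool"
  where "g_symmetric M g A \<longleftrightarrow>
    (\<forall>X\<in>vector_fields M. \<forall>Y\<in>vector_fields M. \<forall>p\<in>points M.
       g p (A p (X p)) (Y p) = g p (X p) (A p (Y p)))"


section \<open>Metallic and almost product structures\<close>

definition metallic_ratio :: "nat \<Rightarrow> nat \<Rightarrow> real"
  where "metallic_ratio a b = (real a + sqrt ((real a)\<^sup>2 + 4 * real b)) / 2"

definition metallic_structure ::
    "('a, 'n::finite) manifold \<Rightarrow> nat \<Rightarrow> nat \<Rightarrow> 'a endo_field \<Rightarrow> bool"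
  where "metallic_structure M a b J \<longleftrightarrow>
    tensor_field_11 M J \<and>
    tensor_eq M (comp_field J J) (comb_field (real a) J (real b) id_field)"

definition almost_product_structure ::
    "('a, 'n::finite) manifold \<Rightarrow> 'a endo_field \<Rightarrow> bool"
  where "almost_product_structure M F \<longleftrightarrow>
    tensor_field_11 M F \<and> tensor_eq M (comp_field F F) id_field"

definition metallic_related ::
    "('a, 'n::finite) manifold \<Rightarrow> nat \<Rightarrow> nat \<Rightarrow> 'a endo_field \<Rightarrow> 'a endo_field \<Rightarrow> bool"
  where "metallic_related M a b F J \<longleftrightarrow>
    tensor_eq M J
      (comb_field (real a / 2) id_field ((2 * metallic_ratio a b - real a) / 2) F)"

lemma metallic_ratio_gap_pos:
  assumes "b > 0"
  shows "2 * metallic_ratio a b - real a > 0"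
  using assms by (simp add: metallic_ratio_def add_nonneg_pos)

lemma metallic_related_iff:
  assumes "b > 0"
  shows "metallic_related M a b F J \<longleftrightarrow>
    tensor_eq M F
      (comb_field (2 / (2 * metallic_ratio a b - real a)) J
        (- (real a / (2 * metallic_ratio a b - real a))) id_field)"
proof -
  define c where "c = 2 * metallic_ratio a b - real a"
  have c: "c > 0"
    unfolding c_def by (rule metallic_ratio_gap_pos [OF assms])
  have "x = real a / 2 * y + c / 2 * z \<longleftrightarrow> z = 2 / c * x + - (real a / c) * y" for x y z :: real
    using c by (auto simp: field_simps)
  then show ?thesis
    unfolding metallic_related_def tensor_eq_def comb_field_def tcomb_def id_field_def
      c_def [symmetric] fun_eq_iff
    by simp
qed

end

theory Submission
  imports Defs
begin

text \<open>
  At each point \<open>J = \<alpha> I + \<beta> F\<close>, so that, by bilinearity and symmetry of \<open>g\<close>,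
  \<open>g(JX, Y) - g(X, JY) = \<beta> (g(FX, Y) - g(X, FY))\<close>: the identity is \<open>g\<close>-symmetric and
  contributes nothing. Since \<open>\<beta> = (2\<rho> - a) / 2\<close> is half of \<open>sqrt (a\<^sup>2 + 4b) > 0\<close>, the two
  defects of symmetry vanish together.
  The defect identity is \<open>symmetry_defect_affine\<close>.
\<close>

lemma symmetric_tensor_field_02_sym:
  assumes "symmetric_tensor_field_02 M g" "p \<in> points M"
    and "u \<in> tangent_space M p" "v \<in> tangent_space M p"
  shows "g p u v = g p v u"
  using assms unfolding symmetric_tensor_field_02_def by blast

lemma symmetric_tensor_field_02_tcomb_left:
  assumes "symmetric_tensor_field_02 M g" "p \<in> points M"
    and "u \<in> tangent_space M p" "v \<in> tangent_space M p" "w \<in> tangent_space M p"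
  shows "g p (tcomb c u d v) w = c * g p u w + d * g p v w"
  using assms unfolding symmetric_tensor_field_02_def by blast

text \<open>
  Linearity of \<open>g\<close> in the second argument comes from that in the first by
  symmetry; the two terms \<open>\<alpha> g(u, v)\<close> then cancel. Stating the result for the
  difference, rather than for symmetry itself, gives both directions of the equivalence
  at once when \<open>\<beta> \<noteq> 0\<close>.
\<close>
lemma symmetry_defect_affine:
  assumes g: "symmetric_tensor_field_02 M g" and F: "tensor_field_11 M F"
    and J: "tensor_field_11 M J" "tensor_eq M J (comb_field \<alpha> id_field \<beta> F)"
    and p: "p \<in> points M" and u: "u \<in> tangent_space M p" and v: "v \<in> tangent_space M p"
  shows "g p (J p u) v - g p u (J p v) = \<beta> * (g p (F p u) v - g p u (F p v))"
proof -
  have Fu: "F p u \<in> tangent_space M p" and Fv: "F p v \<in> tangent_space M p"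
    and Jv: "J p v \<in> tangent_space M p"
    using F J(1) p u v unfolding tensor_field_11_def by blast+
  have Ju_eq: "J p u = tcomb \<alpha> u \<beta> (F p u)" and Jv_eq: "J p v = tcomb \<alpha> v \<beta> (F p v)"
    using J(2) p u v by (simp_all add: tensor_eq_def comb_field_def id_field_def)
  have left: "g p (J p u) v = \<alpha> * g p u v + \<beta> * g p (F p u) v"
    unfolding Ju_eq by (rule symmetric_tensor_field_02_tcomb_left [OF g p u Fu v])
  have "g p u (J p v) = g p (J p v) u"
    by (rule symmetric_tensor_field_02_sym [OF g p u Jv])
  also have "\<dots> = \<alpha> * g p v u + \<beta> * g p (F p v) u"
    unfolding Jv_eq by (rule symmetric_tensor_field_02_tcomb_left [OF g p v Fv u])
  also have "\<dots> = \<alpha> * g p u v + \<beta> * g p u (F p v)"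
    by (simp only: symmetric_tensor_field_02_sym [OF g p v u]
        symmetric_tensor_field_02_sym [OF g p Fv u])
  finally show ?thesis
    using left by (simp add: right_diff_distrib)
qed

lemma g_symmetric_affine_iff:
  assumes "symmetric_tensor_field_02 M g" "tensor_field_11 M F" "tensor_field_11 M J"
    and "tensor_eq M J (comb_field \<alpha> id_field \<beta> F)" and "\<beta> \<noteq> 0"
  shows "g_symmetric M g F \<longleftrightarrow> g_symmetric M g J"
proof -
  have "g p (F p (X p)) (Y p) = g p (X p) (F p (Y p)) \<longleftrightarrow>
      g p (J p (X p)) (Y p) = g p (X p) (J p (Y p))"
    if "X \<in> vector_fields M" "Y \<in> vector_fields M" "p \<in> points M" for X Y p
  proof -
    have "X p \<in> tangent_space M p" "Y p \<in> tangent_space M p"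
      using that unfolding vector_fields_def by blast+
    from symmetry_defect_affine [OF assms(1-4) that(3) this] \<open>\<beta> \<noteq> 0\<close> show ?thesis
      by (metis eq_iff_diff_eq_0 mult_eq_0_iff)
  qed
  then show ?thesis
    unfolding g_symmetric_def by blast
qed

theorem proposition19:
  fixes M :: "('a, 'n::finite) manifold"
    and g :: "'a form_field" and F J :: "'a endo_field" and a b :: nat
  assumes "a > 0" and "b > 0"
    and "smooth_manifold M"
    and "riemannian_metric M g \<or> semi_riemannian_metric M g"
    and "almost_product_structure M F"
    and "metallic_structure M a b J"
    and "metallic_related M a b F J"
  shows "g_symmetric M g F \<longleftrightarrow> g_symmetric M g J"
proof (rule g_symmetric_affine_iff)
  show "symmetric_tensor_field_02 M g"
    using assms(4) unfolding riemannian_metric_def semi_riemannian_metric_def by blast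
  show "tensor_field_11 M F"
    using assms(5) unfolding almost_product_structure_def by blast
  show "tensor_field_11 M J"
    using assms(6) unfolding metallic_structure_def by blast
  show "tensor_eq M J
      (comb_field (real a / 2) id_field ((2 * metallic_ratio a b - real a) / 2) F)"
    using assms(7) unfolding metallic_related_def .
  show "(2 * metallic_ratio a b - real a) / 2 \<noteq> 0"
    using metallic_ratio_gap_pos [OF assms(2), of a] by simp
qed

end
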